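(* Let $X$ be a compact complex manifold, $L$ a big line bundle on $X$, $\phi\in PSH(L)$ a smooth metric, $F$ a line bundle on $X$ and $\psi\in PSH(F)$. Let $\widehat\phi_t$ be the Legendre transform associated to the test curve $\psi_\lambda=\lambda\psi$, $\lambda\in(0,1)$, and let $H$ be the associated exhaustion function. Then, on $X$, $$H=\frac{d\widehat\phi_t}{dt}\bigg|_{t=0^+}.$$
   Context: Metrics are written additively: a (possibly singular) hermitian metric $e^{-\phi}$ on $L$ is identified with its local weights $\phi_f=-\ln|f|^2$. $PSH(L)$ is the set of positive singular metrics on $L$, i.e. metrics whose local weights are plurisubharmonic (upper semicontinuous; $\equiv-\infty$ is allowed). $(\cdot)^*$ denotes upper semicontinuous regularisation. Fix a smooth metric $\phi_F$ on $F$. For $\lambda\in(0,1)$ set $$\phi_\lambda:=\phi_{[\lambda\psi]}:=\Big(\sup\{\gamma\in PSH(L):\ \gamma\le\phi,\ \gamma\le\phi+\lambda(\psi-\phi_F)+C\text{ for some constant }C\}\Big)^*,$$ which is independent of $\phi_F$; set $\phi_\lambda:=\phi$ for $\lambda\le0$ and $\phi_\lambda:=-\infty$ for $\lambda\ge1$. The Legendre transform is $\widehat\phi_t:=\big(\sup_{\lambda\in\mathbb R}\{\phi_\lambda+t\lambda\}\big)^*$ for $t\in[0,\infty)$. The exhaustion function is $H(x)=\sup\{\lambda\in\mathbb R:\ \phi_\lambda(x)=\phi(x)\}$, $x\in X$ (so $H\ge0$). The derivative at $t=0^+$ is the right derivative at $t=0$ for each fixed point $x$ of $X$. *)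

theory Defs
  imports "HOL-Analysis.Analysis" "HOL-Library.Function_Algebras"
begin

section \<open>Functions on open subsets of $C^n$\<close>

text \<open>Holomorphic in several variables: complex differentiable, i.e. Frechet differentiable with
  complex-linear derivative.\<close>

definition cn_holomorphic_on :: "(complex ^ 'n::finite \<Rightarrow> complex) \<Rightarrow> (complex ^ 'n) set \<Rightarrow> bool" where
  "cn_holomorphic_on f V \<longleftrightarrow> open V \<and>
     (\<forall>z\<in>V. \<exists>D. (f has_derivative D) (at z) \<and> (\<forall>c v. D (c *s v) = c * D v))"

text \<open>Class $C^k$, by recursion on the iterated directional derivatives; in finite dimension this is
  the usual notion.\<close>

primrec Ck_on :: "nat \<Rightarrow> ('a::real_normed_vector \<Rightarrow> real) \<Rightarrow> 'a set \<Rightarrow> bool" where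
  "Ck_on 0 f V \<longleftrightarrow> continuous_on V f"
| "Ck_on (Suc k) f V \<longleftrightarrow>
     (\<forall>z\<in>V. f differentiable (at z)) \<and> (\<forall>v. Ck_on k (\<lambda>z. frechet_derivative f (at z) v) V)"

definition Cinf_on :: "('a::real_normed_vector \<Rightarrow> real) \<Rightarrow> 'a set \<Rightarrow> bool" where
  "Cinf_on f V \<longleftrightarrow> open V \<and> (\<forall>k. Ck_on k f V)"

text \<open>Mean of \<^term>\<open>u\<close> over the circle with centre \<^term>\<open>z\<close> in the complex line through
  \<^term>\<open>z\<close> of direction \<^term>\<open>w\<close>, as positive part minus negative part.  For \<^term>\<open>u\<close> upper
  semicontinuous and \<^term>\<open>u < \<infinity>\<close> the positive part is finite, so the difference is
  meaningful; it may be \<^term>\<open>-\<infinity>\<close>.\<close>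

definition circle_mean :: "(complex ^ 'n::finite \<Rightarrow> ereal) \<Rightarrow> complex ^ 'n \<Rightarrow> complex ^ 'n \<Rightarrow> ereal" where
  "circle_mean u z w =
     (enn2ereal (\<integral>\<^sup>+\<theta>\<in>{0..2 * pi}. e2ennreal (u (z + cis \<theta> *s w)) \<partial>lborel)
      - enn2ereal (\<integral>\<^sup>+\<theta>\<in>{0..2 * pi}. e2ennreal (- u (z + cis \<theta> *s w)) \<partial>lborel))
     / ereal (2 * pi)"

text \<open>Plurisubharmonic functions are allowed to be identically \<^term>\<open>-\<infinity>\<close>.\<close>

definition cn_psh_on :: "(complex ^ 'n::finite \<Rightarrow> ereal) \<Rightarrow> (complex ^ 'n) set \<Rightarrow> bool" where
  "cn_psh_on u V \<longleftrightarrow> open V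
     \<and> (\<forall>z\<in>V. u z < \<infinity>)
     \<and> (\<forall>z\<in>V. Limsup (nhds z) u \<le> u z)
     \<and> (\<forall>z w. (\<forall>\<zeta>. cmod \<zeta> \<le> 1 \<longrightarrow> z + \<zeta> *s w \<in> V) \<longrightarrow> u z \<le> circle_mean u z w)"


section \<open>Compact complex manifolds\<close>

text \<open>The underlying space is a whole type; a chart is a domain together with a coordinate map.\<close>

type_synonym ('x, 'n) cchart = "'x set \<times> ('x \<Rightarrow> complex ^ 'n)"

definition complex_atlas :: "('x::t2_space, 'n::finite) cchart set \<Rightarrow> bool" where
  "complex_atlas A \<longleftrightarrow>
     (\<Union>(U, \<kappa>)\<in>A. U) = UNIV
     \<and> (\<forall>(U, \<kappa>)\<in>A. open U \<and> open (\<kappa> ` U) \<and> homeomorphism U (\<kappa> ` U) \<kappa> (inv_into U \<kappa>))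
     \<and> (\<forall>(U, \<kappa>)\<in>A. \<forall>(U', \<kappa>')\<in>A. \<forall>k.
          cn_holomorphic_on (\<lambda>z. \<kappa>' (inv_into U \<kappa> z) $ k) (\<kappa> ` (U \<inter> U')))"

definition compact_complex_manifold :: "('x::t2_space, 'n::finite) cchart set \<Rightarrow> bool" where
  "compact_complex_manifold A \<longleftrightarrow> compact (UNIV :: 'x set) \<and> complex_atlas A"

definition holomorphic_fun_on ::
    "('x::t2_space, 'n::finite) cchart set \<Rightarrow> ('x \<Rightarrow> complex) \<Rightarrow> 'x set \<Rightarrow> bool" where
  "holomorphic_fun_on A f W \<longleftrightarrow> open W \<and>
     (\<forall>(U, \<kappa>)\<in>A. cn_holomorphic_on (f \<circ> inv_into U \<kappa>) (\<kappa> ` (U \<inter> W)))"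

definition smooth_fun_on ::
    "('x::t2_space, 'n::finite) cchart set \<Rightarrow> ('x \<Rightarrow> real) \<Rightarrow> 'x set \<Rightarrow> bool" where
  "smooth_fun_on A f W \<longleftrightarrow> open W \<and>
     (\<forall>(U, \<kappa>)\<in>A. Cinf_on (f \<circ> inv_into U \<kappa>) (\<kappa> ` (U \<inter> W)))"

definition psh_fun_on ::
    "('x::t2_space, 'n::finite) cchart set \<Rightarrow> ('x \<Rightarrow> ereal) \<Rightarrow> 'x set \<Rightarrow> bool" where
  "psh_fun_on A u W \<longleftrightarrow> open W \<and>
     (\<forall>(U, \<kappa>)\<in>A. cn_psh_on (u \<circ> inv_into U \<kappa>) (\<kappa> ` (U \<inter> W)))"


section \<open>Holomorphic line bundles\<close>

text \<open>A line bundle is given by the open sets \<^term>\<open>triv_set L i\<close> of a trivialising cover, carrying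
  local frames $e_i$, and the transition functions $g_{ij}$, where $e_j = g_{ij} e_i$.  A section
  $s = s_i e_i$ thus satisfies $s_i = g_{ij} s_j$.\<close>

record ('i, 'x) line_bundle =
  triv_set :: "'i \<Rightarrow> 'x set"
  trans_fun :: "'i \<Rightarrow> 'i \<Rightarrow> 'x \<Rightarrow> complex"

definition holomorphic_line_bundle ::
    "('x::t2_space, 'n::finite) cchart set \<Rightarrow> ('i, 'x) line_bundle \<Rightarrow> bool" where
  "holomorphic_line_bundle A L \<longleftrightarrow>
     (\<forall>i. open (triv_set L i)) \<and> (\<Union>i. triv_set L i) = UNIV
     \<and> (\<forall>i j. holomorphic_fun_on A (trans_fun L i j) (triv_set L i \<inter> triv_set L j))
     \<and> (\<forall>i j. \<forall>x\<in>triv_set L i \<inter> triv_set L j. trans_fun L i j x \<noteq> 0)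
     \<and> (\<forall>i j k. \<forall>x\<in>triv_set L i \<inter> triv_set L j \<inter> triv_set L k.
          trans_fun L i j x * trans_fun L j k x = trans_fun L i k x)"

text \<open>$H^0(X, kL)$.  The components are normalised to vanish outside the trivialising sets, where they
  carry no information, so that the dimension below is the right one.\<close>

definition global_sections ::
    "('x::t2_space, 'n::finite) cchart set \<Rightarrow> ('i, 'x) line_bundle \<Rightarrow> nat \<Rightarrow> ('i \<Rightarrow> 'x \<Rightarrow> complex) set" where
  "global_sections A L k =
     {s. (\<forall>i. holomorphic_fun_on A (s i) (triv_set L i) \<and> (\<forall>x. x \<notin> triv_set L i \<longrightarrow> s i x = 0))
       \<and> (\<forall>i j. \<forall>x\<in>triv_set L i \<inter> triv_set L j. s i x = trans_fun L i j x ^ k * s j x)}"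

abbreviation scale_section :: "complex \<Rightarrow> ('i \<Rightarrow> 'x \<Rightarrow> complex) \<Rightarrow> 'i \<Rightarrow> 'x \<Rightarrow> complex" where
  "scale_section c s \<equiv> \<lambda>i x. c * s i x"

lemma vector_space_scale_section: "vector_space scale_section"
  by unfold_locales (auto simp: fun_eq_iff algebra_simps)

text \<open>On a compact manifold $H^0(X, kL)$ is finite-dimensional, so the convention that
  \<^const>\<open>vector_space.dim\<close> is 0 in infinite dimension plays no role.\<close>

definition h0 :: "('x::t2_space, 'n::finite) cchart set \<Rightarrow> ('i, 'x) line_bundle \<Rightarrow> nat \<Rightarrow> nat" where
  "h0 A L k = vector_space.dim scale_section (global_sections A L k)"

definition volume :: "('x::t2_space, 'n::finite) cchart set \<Rightarrow> ('i, 'x) line_bundle \<Rightarrow> ereal" where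
  "volume A L = limsup (\<lambda>k. ereal (fact CARD('n) * real (h0 A L k) / real k ^ CARD('n)))"

definition big :: "('x::t2_space, 'n::finite) cchart set \<Rightarrow> ('i, 'x) line_bundle \<Rightarrow> bool" where
  "big A L \<longleftrightarrow> volume A L > 0"


section \<open>Metrics in additive notation\<close>

text \<open>A (possibly singular) metric $e^{-\phi}$ is given by its local weights
  $\phi_i = -\ln |e_i|^2$ with respect to the frames $e_i$; since $e_j = g_{ij} e_i$, they satisfy
  $\phi_i = \phi_j + \ln |g_{ij}|^2$.  The value of $\phi_i$ outside \<^term>\<open>triv_set L i\<close> is
  irrelevant.\<close>

type_synonym ('i, 'x) weights = "'i \<Rightarrow> 'x \<Rightarrow> ereal"

definition is_metric :: "('i, 'x) line_bundle \<Rightarrow> ('i, 'x) weights \<Rightarrow> bool" where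
  "is_metric L \<phi> \<longleftrightarrow> (\<forall>i j. \<forall>x\<in>triv_set L i \<inter> triv_set L j.
     \<phi> i x = \<phi> j x + ereal (ln ((cmod (trans_fun L i j x))\<^sup>2)))"

definition PSH ::
    "('x::t2_space, 'n::finite) cchart set \<Rightarrow> ('i, 'x) line_bundle \<Rightarrow> ('i, 'x) weights set" where
  "PSH A L = {\<phi>. is_metric L \<phi> \<and> (\<forall>i. psh_fun_on A (\<phi> i) (triv_set L i))}"

definition smooth_metric ::
    "('x::t2_space, 'n::finite) cchart set \<Rightarrow> ('i, 'x) line_bundle \<Rightarrow> ('i, 'x) weights \<Rightarrow> bool" where
  "smooth_metric A L \<phi> \<longleftrightarrow> is_metric L \<phi>
     \<and> (\<forall>i. (\<forall>x\<in>triv_set L i. \<bar>\<phi> i x\<bar> \<noteq> \<infinity>)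
           \<and> smooth_fun_on A (\<lambda>x. real_of_ereal (\<phi> i x)) (triv_set L i))"

text \<open>Upper semicontinuous regularisation.  The filter \<^term>\<open>nhds x\<close> includes the point
  \<^term>\<open>x\<close> itself; as the sets \<^term>\<open>triv_set L i\<close> are open, only the relevant values of a weight
  enter.\<close>

definition usc_reg :: "('i, 'x::topological_space) weights \<Rightarrow> ('i, 'x) weights" where
  "usc_reg u = (\<lambda>i x. Limsup (nhds x) (u i))"


section \<open>Test curves, Legendre transform and exhaustion function\<close>

text \<open>The metrics competing in the envelope $\phi_{[\mu\psi]}$.  The function $\psi - \phi_F$ is
  computed in any frame of \<^term>\<open>F\<close> at the point, and compared in any frame of \<^term>\<open>L\<close>.\<close>

definition envelope_competitors ::
    "('x::t2_space, 'n::finite) cchart set \<Rightarrow> ('i, 'x) line_bundle \<Rightarrow> ('i, 'x) weights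
     \<Rightarrow> ('j, 'x) line_bundle \<Rightarrow> ('j, 'x) weights \<Rightarrow> ('j, 'x) weights \<Rightarrow> real \<Rightarrow> ('i, 'x) weights set" where
  "envelope_competitors A L \<phi> F \<psi> \<phi>F \<mu> =
     {\<gamma> \<in> PSH A L.
        (\<forall>i. \<forall>x\<in>triv_set L i. \<gamma> i x \<le> \<phi> i x)
        \<and> (\<exists>C::real. \<forall>i j. \<forall>x\<in>triv_set L i \<inter> triv_set F j.
              \<gamma> i x \<le> \<phi> i x + ereal \<mu> * (\<psi> j x - \<phi>F j x) + ereal C)}"

definition test_curve ::
    "('x::t2_space, 'n::finite) cchart set \<Rightarrow> ('i, 'x) line_bundle \<Rightarrow> ('i, 'x) weights
     \<Rightarrow> ('j, 'x) line_bundle \<Rightarrow> ('j, 'x) weights \<Rightarrow> ('j, 'x) weights \<Rightarrow> real \<Rightarrow> ('i, 'x) weights" where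
  "test_curve A L \<phi> F \<psi> \<phi>F \<mu> =
     (if \<mu> \<le> 0 then \<phi>
      else if \<mu> < 1 then usc_reg (\<lambda>i x. SUP \<gamma>\<in>envelope_competitors A L \<phi> F \<psi> \<phi>F \<mu>. \<gamma> i x)
      else (\<lambda>i x. -\<infinity>))"

definition legendre_transform ::
    "(real \<Rightarrow> ('i, 'x::topological_space) weights) \<Rightarrow> real \<Rightarrow> ('i, 'x) weights" where
  "legendre_transform \<Phi> t = usc_reg (\<lambda>i x. SUP \<mu>. \<Phi> \<mu> i x + ereal (t * \<mu>))"

text \<open>For the test curve above the set contains \<^term>\<open>{..0::real}\<close> and is bounded above by 1, so the
  supremum is a genuine one.\<close>

definition exhaustion ::
    "('i, 'x) line_bundle \<Rightarrow> ('i, 'x) weights \<Rightarrow> (real \<Rightarrow> ('i, 'x) weights) \<Rightarrow> 'x \<Rightarrow> real" where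
  "exhaustion L \<phi> \<Phi> x = Sup {\<mu>. \<forall>i. x \<in> triv_set L i \<longrightarrow> \<Phi> \<mu> i x = \<phi> i x}"

end

theory Submission
  imports Defs
begin

text \<open>Write $\Phi_\mu$ for the test curve.  The theorem is a pointwise statement about decreasing
  families of upper semicontinuous functions.  The properties of $\Phi$ behind it are that it
  decreases in $\mu$, that it equals $\phi$ for $\mu \le 0$ and $-\infty$ for $\mu \ge 1$, and that each $\Phi_\mu$ is upper semicontinuous.

  Fix a point $x$ and write $H$ for $H(x)$.  The bound
  $\widehat\phi_t(x) \ge \phi(x) + t H$ comes from the values $\mu$ with $\Phi_\mu(x) = \phi(x)$.
  For the opposite bound take $h > H$ and choose $c > 0$ with $\Phi_h(x) < \phi(x) - c$.  By upper
  semicontinuity this inequality persists at all $y$ near $x$.  There the parameters $\mu \ge h$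
  contribute at most $\phi(x) - c + t$ to the supremum, as $\Phi_\mu \le \Phi_h$ and only
  $\mu < 1$ counts, while the parameters $\mu \le h$ contribute at most $\phi(y) + t h$,
  where $\phi(y)$ is at most slightly larger than $\phi(x)$.  Hence
  $\widehat\phi_t(x) \le \max(\phi(x) + t h, \phi(x) - c + t)$, and the regularisation in the
  definition of $\widehat\phi_t$ is already accounted for because the estimate holds on a whole
  neighbourhood.  For $t \le c$ the first term is the larger one, so the difference quotient at 0 lies
  between $H$ and $h$.

  Monotonicity of $\Phi$ is where compactness is used: $\psi - \phi_F$ is bounded above, so
  $\nu (\psi - \phi_F) \le \mu (\psi - \phi_F) + C$ for $\mu \le \nu$, so every
  competitor for $\nu$ is one for $\mu$.  A further point is that $H$ is defined by an equality in all
  frames at $x$; since the logarithms of the transition functions are continuous, the regularised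
  envelope is again a metric, and a single frame decides the equality.\<close>

section \<open>Upper limits\<close>

lemma less_of_Limsup_less:
  fixes f :: "'a \<Rightarrow> ereal"
  assumes "Limsup F f < c"
  shows "eventually (\<lambda>y. f y < c) F"
  using assms Limsup_le_iff[of F f "Limsup F f"] by blast

lemma value_le_Limsup_nhds:
  fixes f :: "'a::topological_space \<Rightarrow> ereal"
  shows "f x \<le> Limsup (nhds x) f"
proof (rule ccontr)
  assume "\<not> f x \<le> Limsup (nhds x) f"
  then have "eventually (\<lambda>y. f y < f x) (nhds x)"
    by (intro less_of_Limsup_less) simp
  then show False
    using eventually_nhds_x_imp_x by fastforce
qed

lemma Limsup_nhds_idem:
  fixes f :: "'a::topological_space \<Rightarrow> ereal"
  shows "Limsup (nhds x) (\<lambda>y. Limsup (nhds y) f) \<le> Limsup (nhds x) f"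
  unfolding Limsup_le_iff[of "nhds x" "\<lambda>y. Limsup (nhds y) f"]
proof (intro allI impI)
  fix c assume "Limsup (nhds x) f < c"
  then obtain b where b: "Limsup (nhds x) f < b" "b < c"
    using dense by blast
  have "eventually (\<lambda>y. eventually (\<lambda>z. f z < b) (nhds y)) (nhds x)"
    using less_of_Limsup_less[OF b(1)] by (simp only: eventually_eventually)
  then show "eventually (\<lambda>y. Limsup (nhds y) f < c) (nhds x)"
  proof (rule eventually_mono)
    fix y assume "eventually (\<lambda>z. f z < b) (nhds y)"
    then have "Limsup (nhds y) f \<le> b"
      by (intro Limsup_bounded) (auto elim: eventually_mono)
    then show "Limsup (nhds y) f < c"
      using b(2) by (rule le_less_trans)
  qed
qed

lemma Limsup_add_tendsto:
  fixes u :: "'a \<Rightarrow> ereal" and l :: "'a \<Rightarrow> real"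
  assumes "F \<noteq> bot" and "(l \<longlongrightarrow> c) F"
  shows "Limsup F (\<lambda>x. u x + ereal (l x)) = Limsup F u + ereal c"
proof -
  have le: "Limsup F (\<lambda>x. v x + ereal (m x)) \<le> Limsup F v + ereal d"
    if m: "(m \<longlongrightarrow> d) F" for v :: "'a \<Rightarrow> ereal" and m d
  proof (rule ereal_le_epsilon2)
    fix e :: real assume "0 < e"
    then have "eventually (\<lambda>x. m x < d + e) F"
      using m by (intro order_tendstoD) auto
    then have "eventually (\<lambda>x. v x + ereal (m x) \<le> v x + ereal (d + e)) F"
      by (rule eventually_mono) (intro add_left_mono, simp)
    then have "Limsup F (\<lambda>x. v x + ereal (m x)) \<le> Limsup F (\<lambda>x. v x + ereal (d + e))"
      by (rule Limsup_mono)
    also have "\<dots> = Limsup F v + ereal (d + e)"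
      using assms(1) by (intro Limsup_add_ereal_right) auto
    finally show "Limsup F (\<lambda>x. v x + ereal (m x)) \<le> Limsup F v + ereal d + ereal e"
      by (simp add: add.assoc)
  qed
  have "Limsup F u = Limsup F (\<lambda>x. (u x + ereal (l x)) + ereal (- l x))"
    by (simp add: add.assoc)
  also have "\<dots> \<le> Limsup F (\<lambda>x. u x + ereal (l x)) + ereal (- c)"
    by (intro le tendsto_minus assms(2))
  finally have "Limsup F u + ereal c \<le> Limsup F (\<lambda>x. u x + ereal (l x)) + ereal (- c) + ereal c"
    by (rule add_right_mono)
  then show ?thesis
    using le[OF assms(2), of u] by (simp add: add.assoc antisym)
qed


section \<open>The derivative for a decreasing family of upper semicontinuous functions\<close>

text \<open>The estimate of the regularised Legendre transform from above: split the supremum at a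
  parameter $h$ at which the family has already dropped by more than $c$ at the point.  The choice
  $h = 1$ gives a bound valid for every $t$.\<close>

lemma Limsup_legendre_le:
  fixes u :: "real \<Rightarrow> 'x::topological_space \<Rightarrow> ereal"
  assumes W: "open W" "x \<in> W"
    and anti: "\<And>y \<mu> \<nu>. y \<in> W \<Longrightarrow> \<mu> \<le> \<nu> \<Longrightarrow> u \<nu> y \<le> u \<mu> y"
    and start: "\<And>y \<mu>. y \<in> W \<Longrightarrow> \<mu> \<le> 0 \<Longrightarrow> u \<mu> y = u 0 y"
    and stop: "\<And>y \<mu>. y \<in> W \<Longrightarrow> 1 \<le> \<mu> \<Longrightarrow> u \<mu> y = -\<infinity>"
    and usc: "\<And>\<mu>. Limsup (nhds x) (u \<mu>) \<le> u \<mu> x"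
    and a: "u 0 x = ereal a" and drop: "u h x < ereal (a - c)" and t: "0 \<le> t"
  shows "Limsup (nhds x) (\<lambda>y. SUP \<mu>. u \<mu> y + ereal (t * \<mu>)) \<le> ereal (max (a + t * h) (a - c + t))"
proof (rule ereal_le_epsilon2)
  fix e :: real assume e: "0 < e"
  have "Limsup (nhds x) (u 0) < ereal (a + e)"
    using le_less_trans[OF usc[of 0]] a e by simp
  then have "eventually (\<lambda>y. u 0 y < ereal (a + e)) (nhds x)"
    by (rule less_of_Limsup_less)
  moreover have "eventually (\<lambda>y. u h y < ereal (a - c)) (nhds x)"
    using le_less_trans[OF usc drop] by (rule less_of_Limsup_less)
  moreover have "eventually (\<lambda>y. y \<in> W) (nhds x)"
    using W by (rule eventually_nhds_in_open)
  ultimately have "eventually (\<lambda>y. (SUP \<mu>. u \<mu> y + ereal (t * \<mu>))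
      \<le> ereal (max (a + t * h) (a - c + t) + e)) (nhds x)"
  proof eventually_elim
    case (elim y)
    show ?case
    proof (rule SUP_least)
      fix \<mu> :: real
      consider "\<mu> \<le> h" | "h \<le> \<mu>" "\<mu> < 1" | "1 \<le> \<mu>" by linarith
      then show "u \<mu> y + ereal (t * \<mu>) \<le> ereal (max (a + t * h) (a - c + t) + e)"
      proof cases
        case 1
        have "u \<mu> y \<le> u 0 y"
          using anti[of y 0 \<mu>] start[of y \<mu>] elim(3) by (cases "\<mu> \<le> 0") auto
        then have "u \<mu> y \<le> ereal (a + e)"
          using elim(1) by (meson less_imp_le order_trans)
        then have "u \<mu> y + ereal (t * \<mu>) \<le> ereal (a + e) + ereal (t * h)"
          using 1 t by (intro add_mono) (auto intro: mult_left_mono)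
        also have "\<dots> \<le> ereal (max (a + t * h) (a - c + t) + e)"
          by simp
        finally show ?thesis .
      next
        case 2
        have "u \<mu> y \<le> ereal (a - c)"
          using anti[of y h \<mu>] elim 2 by (meson less_imp_le order_trans)
        moreover have "t * \<mu> \<le> t"
          using mult_left_mono[of \<mu> 1 t] 2 t by simp
        ultimately have "u \<mu> y + ereal (t * \<mu>) \<le> ereal (a - c) + ereal t"
          by (intro add_mono) auto
        also have "\<dots> \<le> ereal (max (a + t * h) (a - c + t) + e)"
          using e by simp
        finally show ?thesis .
      next
        case 3
        then show ?thesis using stop[of y \<mu>] elim(3) by simp
      qed
    qed
  qed
  then show "Limsup (nhds x) (\<lambda>y. SUP \<mu>. u \<mu> y + ereal (t * \<mu>))
      \<le> ereal (max (a + t * h) (a - c + t)) + ereal e"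
    unfolding plus_ereal.simps(1) by (rule Limsup_bounded)
qed

theorem legendre_derivative_of_decreasing_family:
  fixes u :: "real \<Rightarrow> 'x::topological_space \<Rightarrow> ereal"
  assumes W: "open W" "x \<in> W"
    and anti: "\<And>y \<mu> \<nu>. y \<in> W \<Longrightarrow> \<mu> \<le> \<nu> \<Longrightarrow> u \<nu> y \<le> u \<mu> y"
    and start: "\<And>y \<mu>. y \<in> W \<Longrightarrow> \<mu> \<le> 0 \<Longrightarrow> u \<mu> y = u 0 y"
    and stop: "\<And>y \<mu>. y \<in> W \<Longrightarrow> 1 \<le> \<mu> \<Longrightarrow> u \<mu> y = -\<infinity>"
    and usc: "\<And>\<mu>. Limsup (nhds x) (u \<mu>) \<le> u \<mu> x"
    and fin: "\<bar>u 0 x\<bar> \<noteq> \<infinity>"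
  defines "g \<equiv> \<lambda>t. Limsup (nhds x) (\<lambda>y. SUP \<mu>. u \<mu> y + ereal (t * \<mu>))"
  shows "\<forall>t\<ge>0. \<bar>g t\<bar> \<noteq> \<infinity>"
    and "((\<lambda>t. real_of_ereal (g t)) has_real_derivative Sup {\<mu>. u \<mu> x = u 0 x}) (at_right 0)"
proof -
  define S where "S = {\<mu>. u \<mu> x = u 0 x}"
  define H where "H = Sup S"
  obtain a where a: "u 0 x = ereal a"
    using fin by (cases "u 0 x") auto
  have "0 \<in> S"
    by (simp add: S_def)
  have S1: "\<mu> \<le> 1" if "\<mu> \<in> S" for \<mu>
    using stop[of x \<mu>] that W(2) a by (cases "1 \<le> \<mu>") (auto simp: S_def)
  then have bdd: "bdd_above S"
    by (rule bdd_aboveI)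
  have upper: "g t \<le> ereal (max (a + t * h) (a - c + t))"
    if "0 \<le> t" "u h x < ereal (a - c)" for t h c
    unfolding g_def using Limsup_legendre_le[of W x u, OF W anti start stop usc a] that by blast
  have crude: "g t \<le> ereal (a + t)" if "0 \<le> t" for t
    using upper[of t 1 0] that stop[of x 1] W(2) by simp
  have in_S: "ereal (a + t * \<mu>) \<le> g t" if "\<mu> \<in> S" for t \<mu>
  proof -
    have "ereal (a + t * \<mu>) = u \<mu> x + ereal (t * \<mu>)"
      using that a by (simp add: S_def)
    also have "\<dots> \<le> (SUP \<mu>. u \<mu> x + ereal (t * \<mu>))"
      by (rule SUP_upper) simp
    also have "\<dots> \<le> g t"
      unfolding g_def by (rule value_le_Limsup_nhds)
    finally show ?thesis .
  qed
  have g: "\<bar>g t\<bar> \<noteq> \<infinity>" if "0 \<le> t" for t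
    using crude[OF that] in_S[OF \<open>0 \<in> S\<close>, of t] by (cases "g t") auto
  then show "\<forall>t\<ge>0. \<bar>g t\<bar> \<noteq> \<infinity>"
    by blast
  have g0: "real_of_ereal (g 0) = a"
    using crude[of 0] in_S[OF \<open>0 \<in> S\<close>, of 0] by (cases "g 0") auto
  have lower: "a + t * H \<le> real_of_ereal (g t)" if "0 < t" for t
  proof -
    obtain r where r: "g t = ereal r"
      using g[of t] \<open>0 < t\<close> by (cases "g t") auto
    have "\<mu> \<le> (real_of_ereal (g t) - a) / t" if "\<mu> \<in> S" for \<mu>
      using in_S[OF that, of t] \<open>0 < t\<close> by (simp add: r field_simps)
    then have "H \<le> (real_of_ereal (g t) - a) / t"
      unfolding H_def using \<open>0 \<in> S\<close> by (intro cSup_least) auto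
    then show ?thesis
      using that by (simp add: field_simps)
  qed
  have "0 \<le> H"
    unfolding H_def using \<open>0 \<in> S\<close> bdd by (rule cSup_upper)
  have "((\<lambda>t. (real_of_ereal (g t) - real_of_ereal (g 0)) / (t - 0)) \<longlongrightarrow> H) (at_right 0)"
  proof (rule tendstoI)
    fix e :: real assume e: "0 < e"
    \<comment> \<open>Beyond the supremum of $S$ the family has strictly dropped at $x$.\<close>
    define h where "h = H + e / 2"
    have "h \<notin> S"
      using cSup_upper[OF _ bdd, of h] e by (auto simp: h_def H_def)
    moreover have "u h x \<le> u 0 x"
      using anti[of x 0 h] W(2) \<open>0 \<le> H\<close> e by (simp add: h_def)
    ultimately have "u h x < ereal a"
      using a by (auto simp: S_def less_le)
    then obtain b where b: "u h x < ereal b" "b < a"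
      using ereal_dense2[of "u h x" "ereal a"] by auto
    have "\<forall>t>0. t < a - b \<longrightarrow>
        dist ((real_of_ereal (g t) - real_of_ereal (g 0)) / (t - 0)) H < e"
    proof (intro allI impI)
      fix t :: real assume t: "0 < t" "t < a - b"
      have "0 \<le> t * h"
        using t \<open>0 \<le> H\<close> e by (simp add: h_def)
      then have "g t \<le> ereal (a + t * h)"
        using upper[of t h "a - b"] b t by (simp add: max_def)
      then have "real_of_ereal (g t) \<le> a + t * h"
        using g[of t] t by (cases "g t") auto
      then have "(real_of_ereal (g t) - a) / t \<le> h" "H \<le> (real_of_ereal (g t) - a) / t"
        using lower[of t] t by (simp_all add: field_simps)
      then show "dist ((real_of_ereal (g t) - real_of_ereal (g 0)) / (t - 0)) H < e"
        using e by (simp add: g0 h_def dist_real_def)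
    qed
    then show "eventually (\<lambda>t. dist ((real_of_ereal (g t) - real_of_ereal (g 0)) / (t - 0)) H < e)
        (at_right 0)"
      using b(2) by (auto simp: eventually_at_right_field intro!: exI[of _ "a - b"])
  qed
  then show "((\<lambda>t. real_of_ereal (g t)) has_real_derivative Sup {\<mu>. u \<mu> x = u 0 x}) (at_right 0)"
    by (simp add: has_field_derivative_iff H_def S_def)
qed


section \<open>From charts to the manifold\<close>

lemma eventually_nhds_chart:
  assumes "complex_atlas A" "(U, \<kappa>) \<in> A" "x \<in> U"
    and "eventually (\<lambda>z. P (inv_into U \<kappa> z)) (nhds (\<kappa> x))"
  shows "eventually P (nhds x)"
proof -
  have U: "open U" and hom: "homeomorphism U (\<kappa> ` U) \<kappa> (inv_into U \<kappa>)"
    using assms(1,2) by (auto simp: complex_atlas_def)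
  have "isCont \<kappa> x"
    using homeomorphism_cont1[OF hom] U assms(3) continuous_on_eq_continuous_at by blast
  then have "filterlim \<kappa> (nhds (\<kappa> x)) (nhds x)"
    by (simp add: isCont_def tendsto_at_iff_tendsto_nhds)
  then have "eventually (\<lambda>y. P (inv_into U \<kappa> (\<kappa> y))) (nhds x)"
    using assms(4) by (rule eventually_compose_filterlim[rotated])
  moreover have "eventually (\<lambda>y. y \<in> U) (nhds x)"
    using U assms(3) by (rule eventually_nhds_in_open)
  ultimately show ?thesis
  proof eventually_elim
    case (elim y)
    then show ?case
      using homeomorphism_apply1[OF hom, of y] by simp
  qed
qed

lemma chart_at:
  assumes "complex_atlas A"
  obtains U \<kappa> where "(U, \<kappa>) \<in> A" "x \<in> U" "inv_into U \<kappa> (\<kappa> x) = x"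
proof -
  have "x \<in> (\<Union>(U, \<kappa>)\<in>A. U)"
    using assms by (simp add: complex_atlas_def)
  then obtain U \<kappa> where c: "(U, \<kappa>) \<in> A" "x \<in> U"
    by auto
  then have "homeomorphism U (\<kappa> ` U) \<kappa> (inv_into U \<kappa>)"
    using assms by (auto simp: complex_atlas_def)
  then show thesis
    using homeomorphism_apply1[of U _ \<kappa> _ x] c by (intro that) auto
qed

lemma isCont_chart:
  assumes "complex_atlas A" "(U, \<kappa>) \<in> A" "x \<in> U" "inv_into U \<kappa> (\<kappa> x) = x"
    and "isCont (f \<circ> inv_into U \<kappa>) (\<kappa> x)"
  shows "isCont f x"
proof -
  have "((f \<circ> inv_into U \<kappa>) \<longlongrightarrow> (f \<circ> inv_into U \<kappa>) (\<kappa> x)) (nhds (\<kappa> x))"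
    using assms(5) by (simp only: isCont_def tendsto_at_iff_tendsto_nhds)
  then have "(f \<longlongrightarrow> f x) (nhds x)"
    using assms(4) by (auto simp: tendsto_def intro: eventually_nhds_chart[OF assms(1-3)])
  then show ?thesis
    by (simp only: isCont_def tendsto_at_iff_tendsto_nhds)
qed

lemma isCont_smooth_fun:
  assumes "complex_atlas A" "smooth_fun_on A f W" "x \<in> W"
  shows "isCont f x"
proof -
  obtain U \<kappa> where c: "(U, \<kappa>) \<in> A" "x \<in> U" "inv_into U \<kappa> (\<kappa> x) = x"
    using chart_at[OF assms(1)] .
  have "Cinf_on (f \<circ> inv_into U \<kappa>) (\<kappa> ` (U \<inter> W))"
    using assms(2) c by (auto simp: smooth_fun_on_def)
  then have "open (\<kappa> ` (U \<inter> W))" "Ck_on 0 (f \<circ> inv_into U \<kappa>) (\<kappa> ` (U \<inter> W))"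
    unfolding Cinf_on_def by blast+
  then have "isCont (f \<circ> inv_into U \<kappa>) (\<kappa> x)"
    using c assms(3) by (simp add: continuous_on_eq_continuous_at o_def)
  then show ?thesis
    by (rule isCont_chart[OF assms(1) c])
qed

lemma isCont_holomorphic_fun:
  assumes "complex_atlas A" "holomorphic_fun_on A f W" "x \<in> W"
  shows "isCont f x"
proof -
  obtain U \<kappa> where c: "(U, \<kappa>) \<in> A" "x \<in> U" "inv_into U \<kappa> (\<kappa> x) = x"
    using chart_at[OF assms(1)] .
  have "cn_holomorphic_on (f \<circ> inv_into U \<kappa>) (\<kappa> ` (U \<inter> W))"
    using assms(2) c by (auto simp: holomorphic_fun_on_def)
  moreover have "\<kappa> x \<in> \<kappa> ` (U \<inter> W)"
    using c(2) assms(3) by simp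
  ultimately obtain D where "((f \<circ> inv_into U \<kappa>) has_derivative D) (at (\<kappa> x))"
    unfolding cn_holomorphic_on_def by metis
  then have "isCont (f \<circ> inv_into U \<kappa>) (\<kappa> x)"
    by (rule has_derivative_continuous)
  then show ?thesis
    by (rule isCont_chart[OF assms(1) c])
qed

lemma psh_fun_usc:
  assumes "complex_atlas A" "psh_fun_on A u W" "x \<in> W"
  shows "u x < \<infinity>" and "Limsup (nhds x) u \<le> u x"
proof -
  obtain U \<kappa> where c: "(U, \<kappa>) \<in> A" "x \<in> U" "inv_into U \<kappa> (\<kappa> x) = x"
    using chart_at[OF assms(1)] .
  have psh: "cn_psh_on (u \<circ> inv_into U \<kappa>) (\<kappa> ` (U \<inter> W))"
    using assms(2) c by (auto simp: psh_fun_on_def)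
  have x: "\<kappa> x \<in> \<kappa> ` (U \<inter> W)"
    using c assms(3) by blast
  show "u x < \<infinity>"
    using psh x c(3) unfolding cn_psh_on_def by fastforce
  have le: "Limsup (nhds (\<kappa> x)) (u \<circ> inv_into U \<kappa>) \<le> u x"
    using psh x c(3) unfolding cn_psh_on_def by fastforce
  show "Limsup (nhds x) u \<le> u x"
    unfolding Limsup_le_iff[of "nhds x" u]
  proof (intro allI impI)
    fix b assume "u x < b"
    then have "eventually (\<lambda>z. (u \<circ> inv_into U \<kappa>) z < b) (nhds (\<kappa> x))"
      using less_of_Limsup_less le_less_trans[OF le] by blast
    then show "eventually (\<lambda>y. u y < b) (nhds x)"
      using eventually_nhds_chart[OF assms(1) c(1,2)] by simp
  qed
qed


section \<open>Metrics and frames\<close>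

lemma isCont_log_transition:
  assumes "complex_atlas A" "holomorphic_line_bundle A L" "x \<in> triv_set L i \<inter> triv_set L j"
  shows "isCont (\<lambda>y. ln ((cmod (trans_fun L i j y))\<^sup>2)) x"
proof -
  have "isCont (trans_fun L i j) x" "trans_fun L i j x \<noteq> 0"
    using assms isCont_holomorphic_fun[OF assms(1)] unfolding holomorphic_line_bundle_def by blast+
  then show ?thesis
    by (intro continuous_intros) auto
qed

lemma is_metric_frame:
  assumes "is_metric L \<phi>" "x \<in> triv_set L i" "x \<in> triv_set L j"
  shows "\<phi> i x = \<phi> j x + ereal (ln ((cmod (trans_fun L i j x))\<^sup>2))"
  using assms unfolding is_metric_def by blast

lemma is_metric_SUP:
  assumes "\<And>\<gamma>. \<gamma> \<in> S \<Longrightarrow> is_metric L \<gamma>"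
  shows "is_metric L (\<lambda>i x. SUP \<gamma>\<in>S. \<gamma> i x)"
proof (cases "S = {}")
  case True
  then show ?thesis by (simp add: is_metric_def bot_ereal_def)
next
  case False
  show ?thesis
    unfolding is_metric_def
  proof (intro allI ballI)
    fix i j x assume x: "x \<in> triv_set L i \<inter> triv_set L j"
    have "(SUP \<gamma>\<in>S. \<gamma> i x) = (SUP \<gamma>\<in>S. \<gamma> j x + ereal (ln ((cmod (trans_fun L i j x))\<^sup>2)))"
      using assms x by (intro SUP_cong) (auto intro: is_metric_frame)
    also have "\<dots> = (SUP \<gamma>\<in>S. \<gamma> j x) + ereal (ln ((cmod (trans_fun L i j x))\<^sup>2))"
      using False by (intro SUP_ereal_add_left) auto
    finally show "(SUP \<gamma>\<in>S. \<gamma> i x)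
        = (SUP \<gamma>\<in>S. \<gamma> j x) + ereal (ln ((cmod (trans_fun L i j x))\<^sup>2))" .
  qed
qed

text \<open>Regularisation commutes with a change of frame because the logarithm of the modulus of a
  transition function is continuous.\<close>

lemma is_metric_usc_reg:
  assumes "complex_atlas A" and L: "holomorphic_line_bundle A L" and v: "is_metric L v"
  shows "is_metric L (usc_reg v)"
  unfolding is_metric_def
proof (intro allI ballI)
  fix i j x assume x: "x \<in> triv_set L i \<inter> triv_set L j"
  define l where "l = (\<lambda>y. ln ((cmod (trans_fun L i j y))\<^sup>2))"
  have "open (triv_set L i \<inter> triv_set L j)"
    using L by (auto simp: holomorphic_line_bundle_def)
  then have "eventually (\<lambda>y. y \<in> triv_set L i \<inter> triv_set L j) (nhds x)"
    using x by (rule eventually_nhds_in_open)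
  then have "eventually (\<lambda>y. v i y = v j y + ereal (l y)) (nhds x)"
    unfolding l_def by (rule eventually_mono) (use v in \<open>auto intro: is_metric_frame\<close>)
  then have "Limsup (nhds x) (v i) = Limsup (nhds x) (\<lambda>y. v j y + ereal (l y))"
    by (rule Limsup_eq)
  also have "isCont l x"
    unfolding l_def using assms(1) L x by (rule isCont_log_transition)
  then have "(l \<longlongrightarrow> l x) (nhds x)"
    by (simp only: isCont_def tendsto_at_iff_tendsto_nhds)
  then have "Limsup (nhds x) (\<lambda>y. v j y + ereal (l y)) = Limsup (nhds x) (v j) + ereal (l x)"
    by (intro Limsup_add_tendsto) simp
  finally show "usc_reg v i x = usc_reg v j x + ereal (ln ((cmod (trans_fun L i j x))\<^sup>2))"
    by (simp add: usc_reg_def l_def)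
qed

text \<open>The difference of two metrics on the same bundle is a function, so
  $\psi - \phi_F$ can be estimated near each point in one frame.  There it is bounded above because
  $\psi$ is upper semicontinuous and $\phi_F$ is continuous, and finitely many such neighbourhoods
  cover the manifold.\<close>

lemma psh_minus_smooth_bounded_above:
  fixes A :: "('x::t2_space, 'n::finite) cchart set"
  assumes X: "compact_complex_manifold A" and F: "holomorphic_line_bundle A F"
    and \<psi>: "\<psi> \<in> PSH A F" and \<phi>F: "smooth_metric A F \<phi>F"
  shows "\<exists>K::real. \<forall>j. \<forall>x\<in>triv_set F j. \<psi> j x - \<phi>F j x \<le> ereal K"
proof -
  have atlas: "complex_atlas A" and comp: "compact (UNIV :: 'x set)"
    using X by (auto simp: compact_complex_manifold_def)
  have frame: "\<psi> j y - \<phi>F j y = \<psi> k y - \<phi>F k y" if y: "y \<in> triv_set F j" "y \<in> triv_set F k" for j k y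
  proof -
    define l where "l = ln ((cmod (trans_fun F j k y))\<^sup>2)"
    have "\<psi> j y = \<psi> k y + ereal l" "\<phi>F j y = \<phi>F k y + ereal l"
      using \<psi> \<phi>F y unfolding PSH_def smooth_metric_def l_def by (auto dest: is_metric_frame)
    moreover have "\<bar>\<phi>F k y\<bar> \<noteq> \<infinity>"
      using \<phi>F y by (auto simp: smooth_metric_def)
    ultimately show ?thesis
      by (cases "\<psi> k y"; cases "\<phi>F k y") auto
  qed
  define N :: "('x set \<times> real) set" where
    "N = {(V, c). open V \<and> (\<forall>y\<in>V. \<forall>j. y \<in> triv_set F j \<longrightarrow> \<psi> j y - \<phi>F j y \<le> ereal c)}"
  have "\<exists>p\<in>N. x \<in> fst p" for x
  proof -
    obtain k where k: "x \<in> triv_set F k"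
      using F unfolding holomorphic_line_bundle_def by blast
    have psh: "psh_fun_on A (\<psi> k) (triv_set F k)"
      using \<psi> by (auto simp: PSH_def)
    obtain a where a: "\<psi> k x < ereal a"
      using psh_fun_usc(1)[OF atlas psh k] ereal_dense2 by blast
    define f where "f = (\<lambda>y. real_of_ereal (\<phi>F k y))"
    have f: "\<phi>F k y = ereal (f y)" if "y \<in> triv_set F k" for y
      using \<phi>F that by (auto simp: smooth_metric_def f_def ereal_real')
    have "isCont f x"
      using \<phi>F k by (intro isCont_smooth_fun[OF atlas]) (auto simp: smooth_metric_def f_def)
    then have "(f \<longlongrightarrow> f x) (nhds x)"
      by (simp only: isCont_def tendsto_at_iff_tendsto_nhds)
    then have "eventually (\<lambda>y. f x - 1 < f y) (nhds x)"
      by (rule order_tendstoD) simp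
    moreover have "eventually (\<lambda>y. \<psi> k y < ereal a) (nhds x)"
      using le_less_trans[OF psh_fun_usc(2)[OF atlas psh k] a] by (rule less_of_Limsup_less)
    moreover have "eventually (\<lambda>y. y \<in> triv_set F k) (nhds x)"
      using F k by (intro eventually_nhds_in_open) (auto simp: holomorphic_line_bundle_def)
    ultimately have "eventually (\<lambda>y. y \<in> triv_set F k \<and> \<psi> k y - \<phi>F k y \<le> ereal (a - f x + 1)) (nhds x)"
    proof eventually_elim
      case (elim y)
      then show ?case
        by (cases "\<psi> k y") (auto simp: f)
    qed
    then obtain V where V: "open V" "x \<in> V"
      "\<And>y. y \<in> V \<Longrightarrow> y \<in> triv_set F k \<and> \<psi> k y - \<phi>F k y \<le> ereal (a - f x + 1)"
      unfolding eventually_nhds by blast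
    have "\<psi> j y - \<phi>F j y \<le> ereal (a - f x + 1)" if "y \<in> V" "y \<in> triv_set F j" for y j
      using V(3)[OF that(1)] frame[of y j k] that(2) by metis
    then have "(V, a - f x + 1) \<in> N"
      using V(1) by (simp add: N_def)
    then show ?thesis
      using V(2) by (metis fst_conv)
  qed
  then have cover: "UNIV \<subseteq> (\<Union>p\<in>N. fst p)"
    by blast
  have "open (fst p)" if "p \<in> N" for p
    using that by (auto simp: N_def)
  then obtain T where T: "T \<subseteq> N" "finite T" "UNIV \<subseteq> (\<Union>p\<in>T. fst p)"
    using compactE_image[OF comp _ cover] by metis
  show ?thesis
  proof (intro exI allI ballI)
    fix j y assume y: "y \<in> triv_set F j"
    obtain p where p: "p \<in> T" "y \<in> fst p"
      using T(3) by blast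
    have "\<psi> j y - \<phi>F j y \<le> ereal (snd p)"
      using T(1) p y by (auto simp: N_def)
    also have "snd p \<le> Max (snd ` T)"
      using T(2) p(1) by simp
    finally show "\<psi> j y - \<phi>F j y \<le> ereal (Max (snd ` T))"
      by simp
  qed
qed


section \<open>The test curve\<close>

lemma envelope_competitors_antimono:
  assumes "compact_complex_manifold A" "holomorphic_line_bundle A F"
    and "\<psi> \<in> PSH A F" "smooth_metric A F \<phi>F" and \<mu>: "0 < \<mu>" "\<mu> \<le> \<nu>"
  shows "envelope_competitors A L \<phi> F \<psi> \<phi>F \<nu> \<subseteq> envelope_competitors A L \<phi> F \<psi> \<phi>F \<mu>"
proof
  fix \<gamma> assume \<gamma>: "\<gamma> \<in> envelope_competitors A L \<phi> F \<psi> \<phi>F \<nu>"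
  obtain K where K: "\<And>j x. x \<in> triv_set F j \<Longrightarrow> \<psi> j x - \<phi>F j x \<le> ereal K"
    using psh_minus_smooth_bounded_above[OF assms(1-4)] by metis
  obtain C where C: "\<And>i j x. x \<in> triv_set L i \<inter> triv_set F j \<Longrightarrow>
      \<gamma> i x \<le> \<phi> i x + ereal \<nu> * (\<psi> j x - \<phi>F j x) + ereal C"
    using \<gamma> unfolding envelope_competitors_def by blast
  have "\<gamma> i x \<le> \<phi> i x + ereal \<mu> * (\<psi> j x - \<phi>F j x) + ereal ((\<nu> - \<mu>) * K + C)"
    if x: "x \<in> triv_set L i \<inter> triv_set F j" for i j x
  proof -
    have "ereal \<nu> * (\<psi> j x - \<phi>F j x) \<le> ereal \<mu> * (\<psi> j x - \<phi>F j x) + ereal ((\<nu> - \<mu>) * K)"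
    proof (cases "\<psi> j x - \<phi>F j x")
      case (real d)
      then have "(\<nu> - \<mu>) * d \<le> (\<nu> - \<mu>) * K"
        using K[of x j] x \<mu> by (intro mult_left_mono) auto
      then show ?thesis
        using real by (simp add: algebra_simps)
    next
      case PInf
      then show ?thesis using K[of x j] x by simp
    next
      case MInf
      then show ?thesis using \<mu> by simp
    qed
    then have "\<phi> i x + ereal \<nu> * (\<psi> j x - \<phi>F j x) + ereal C
        \<le> \<phi> i x + (ereal \<mu> * (\<psi> j x - \<phi>F j x) + ereal ((\<nu> - \<mu>) * K)) + ereal C"
      by (intro add_mono) auto
    also have "\<dots> = \<phi> i x + ereal \<mu> * (\<psi> j x - \<phi>F j x) + ereal ((\<nu> - \<mu>) * K + C)"
      by (simp only: add.assoc plus_ereal.simps(1)[symmetric])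
    finally show ?thesis
      using C[OF x] by (rule order_trans[rotated])
  qed
  then show "\<gamma> \<in> envelope_competitors A L \<phi> F \<psi> \<phi>F \<mu>"
    using \<gamma> unfolding envelope_competitors_def by blast
qed

lemma is_metric_test_curve:
  assumes "complex_atlas A" "holomorphic_line_bundle A L" "is_metric L \<phi>"
  shows "is_metric L (test_curve A L \<phi> F \<psi> \<phi>F \<mu>)"
proof -
  have "is_metric L (usc_reg (\<lambda>i x. SUP \<gamma>\<in>envelope_competitors A L \<phi> F \<psi> \<phi>F \<mu>. \<gamma> i x))"
    by (intro is_metric_usc_reg[OF assms(1,2)] is_metric_SUP)
      (auto simp: envelope_competitors_def PSH_def)
  moreover have "is_metric L (\<lambda>i x. -\<infinity>)"
    by (simp add: is_metric_def)
  ultimately show ?thesis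
    using assms(3) by (simp add: test_curve_def)
qed

lemma test_curve_usc:
  assumes "complex_atlas A" "\<phi> \<in> PSH A L" "x \<in> triv_set L i"
  shows "Limsup (nhds x) (test_curve A L \<phi> F \<psi> \<phi>F \<mu> i) \<le> test_curve A L \<phi> F \<psi> \<phi>F \<mu> i x"
proof -
  have "psh_fun_on A (\<phi> i) (triv_set L i)"
    using assms(2) by (auto simp: PSH_def)
  then have "Limsup (nhds x) (\<phi> i) \<le> \<phi> i x"
    using psh_fun_usc(2)[OF assms(1)] assms(3) by blast
  then show ?thesis
    by (auto simp: test_curve_def usc_reg_def Limsup_nhds_idem Limsup_const)
qed

lemma test_curve_antimono:
  fixes A :: "('x::t2_space, 'n::finite) cchart set"
  assumes X: "compact_complex_manifold A" and L: "holomorphic_line_bundle A L" "\<phi> \<in> PSH A L"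
    and F: "holomorphic_line_bundle A F" "\<psi> \<in> PSH A F" "smooth_metric A F \<phi>F"
    and x: "x \<in> triv_set L i" and "\<mu> \<le> \<nu>"
  shows "test_curve A L \<phi> F \<psi> \<phi>F \<nu> i x \<le> test_curve A L \<phi> F \<psi> \<phi>F \<mu> i x"
proof -
  let ?E = "envelope_competitors A L \<phi> F \<psi> \<phi>F"
  have atlas: "complex_atlas A"
    using X by (simp add: compact_complex_manifold_def)
  consider "\<nu> \<le> 0" | "1 \<le> \<nu>" | "\<mu> \<le> 0" "0 < \<nu>" "\<nu> < 1" | "0 < \<mu>" "\<nu> < 1"
    by linarith
  then show ?thesis
  proof cases
    case 1
    then show ?thesis using \<open>\<mu> \<le> \<nu>\<close> by (simp add: test_curve_def)
  next
    case 2
    then show ?thesis by (simp add: test_curve_def)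
  next
    case 3
    have "eventually (\<lambda>y. y \<in> triv_set L i) (nhds x)"
      using L(1) x by (intro eventually_nhds_in_open) (auto simp: holomorphic_line_bundle_def)
    then have "eventually (\<lambda>y. (SUP \<gamma>\<in>?E \<nu>. \<gamma> i y) \<le> \<phi> i y) (nhds x)"
      by (rule eventually_mono) (auto simp: envelope_competitors_def intro: SUP_least)
    then have "Limsup (nhds x) (\<lambda>y. SUP \<gamma>\<in>?E \<nu>. \<gamma> i y) \<le> Limsup (nhds x) (\<phi> i)"
      by (rule Limsup_mono)
    also have "\<dots> \<le> \<phi> i x"
      using test_curve_usc[OF atlas L(2) x, of F \<psi> \<phi>F 0] by (simp add: test_curve_def)
    finally show ?thesis
      using 3 by (simp add: test_curve_def usc_reg_def)
  next
    case 4
    then have "?E \<nu> \<subseteq> ?E \<mu>"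
      using envelope_competitors_antimono[OF X F] \<open>\<mu> \<le> \<nu>\<close> by blast
    then have "Limsup (nhds x) (\<lambda>y. SUP \<gamma>\<in>?E \<nu>. \<gamma> i y) \<le> Limsup (nhds x) (\<lambda>y. SUP \<gamma>\<in>?E \<mu>. \<gamma> i y)"
      by (intro Limsup_mono always_eventually allI SUP_subset_mono) auto
    then show ?thesis
      using 4 \<open>\<mu> \<le> \<nu>\<close> by (simp add: test_curve_def usc_reg_def)
  qed
qed

lemma exhaustion_eq_Sup_in_frame:
  assumes "is_metric L \<phi>" and "\<And>\<mu>. is_metric L (\<Phi> \<mu>)" and x: "x \<in> triv_set L i"
  shows "exhaustion L \<phi> \<Phi> x = Sup {\<mu>. \<Phi> \<mu> i x = \<phi> i x}"
proof -
  have "\<Phi> \<mu> j x = \<phi> j x" if "x \<in> triv_set L j" "\<Phi> \<mu> i x = \<phi> i x" for j \<mu>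
    using is_metric_frame[OF assms(1) that(1) x] is_metric_frame[OF assms(2) that(1) x] that(2)
    by simp
  then have "{\<mu>. \<forall>j. x \<in> triv_set L j \<longrightarrow> \<Phi> \<mu> j x = \<phi> j x} = {\<mu>. \<Phi> \<mu> i x = \<phi> i x}"
    using x by blast
  then show ?thesis
    by (simp add: exhaustion_def)
qed

theorem theorem1p9:
  fixes A :: "('x::t2_space, 'n::finite) cchart set"
    and L :: "('i, 'x) line_bundle" and F :: "('j, 'x) line_bundle"
    and \<phi> :: "('i, 'x) weights" and \<psi> \<phi>F :: "('j, 'x) weights"
  assumes "compact_complex_manifold A"
    and "holomorphic_line_bundle A L" and "big A L"
    and "\<phi> \<in> PSH A L" and "smooth_metric A L \<phi>"
    and "holomorphic_line_bundle A F"
    and "\<psi> \<in> PSH A F" and "smooth_metric A F \<phi>F"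
  shows "let \<Phi> = test_curve A L \<phi> F \<psi> \<phi>F in
         \<forall>x. \<forall>i. x \<in> triv_set L i \<longrightarrow>
           (\<forall>t\<ge>0. \<bar>legendre_transform \<Phi> t i x\<bar> \<noteq> \<infinity>) \<and>
           ((\<lambda>t. real_of_ereal (legendre_transform \<Phi> t i x))
              has_real_derivative exhaustion L \<phi> \<Phi> x) (at_right 0)"
proof -
  define \<Phi> where "\<Phi> = test_curve A L \<phi> F \<psi> \<phi>F"
  have atlas: "complex_atlas A"
    using assms(1) by (simp add: compact_complex_manifold_def)
  have \<Phi>0: "\<Phi> \<mu> = \<phi>" if "\<mu> \<le> 0" for \<mu>
    using that by (simp add: \<Phi>_def test_curve_def)
  have metric: "is_metric L \<phi>"
    using assms(4) by (simp add: PSH_def)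
  have "(\<forall>t\<ge>0. \<bar>legendre_transform \<Phi> t i x\<bar> \<noteq> \<infinity>) \<and>
      ((\<lambda>t. real_of_ereal (legendre_transform \<Phi> t i x))
        has_real_derivative exhaustion L \<phi> \<Phi> x) (at_right 0)"
    if x: "x \<in> triv_set L i" for x i
  proof -
    have W: "open (triv_set L i)"
      using assms(2) by (simp add: holomorphic_line_bundle_def)
    have anti: "\<Phi> \<nu> i y \<le> \<Phi> \<mu> i y" if "y \<in> triv_set L i" "\<mu> \<le> \<nu>" for y \<mu> \<nu>
      unfolding \<Phi>_def using test_curve_antimono[OF assms(1,2,4,6-8)] that .
    have start: "\<Phi> \<mu> i y = \<Phi> 0 i y" if "y \<in> triv_set L i" "\<mu> \<le> 0" for y \<mu>
      using \<Phi>0 that by simp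
    have stop: "\<Phi> \<mu> i y = -\<infinity>" if "y \<in> triv_set L i" "1 \<le> \<mu>" for y \<mu>
      using that by (simp add: \<Phi>_def test_curve_def)
    have usc: "Limsup (nhds x) (\<Phi> \<mu> i) \<le> \<Phi> \<mu> i x" for \<mu>
      unfolding \<Phi>_def using atlas assms(4) x by (rule test_curve_usc)
    have fin: "\<bar>\<Phi> 0 i x\<bar> \<noteq> \<infinity>"
      using assms(5) x \<Phi>0 by (simp add: smooth_metric_def)
    have "is_metric L (\<Phi> \<mu>)" for \<mu>
      unfolding \<Phi>_def by (rule is_metric_test_curve[OF atlas assms(2) metric])
    then have "exhaustion L \<phi> \<Phi> x = Sup {\<mu>. \<Phi> \<mu> i x = \<Phi> 0 i x}"
      using exhaustion_eq_Sup_in_frame[OF metric _ x] \<Phi>0 by simp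
    then show ?thesis
      using legendre_derivative_of_decreasing_family[of "triv_set L i" x "\<lambda>\<mu>. \<Phi> \<mu> i",
          OF W x anti start stop usc fin]
      by (simp add: legendre_transform_def usc_reg_def)
  qed
  then show ?thesis
    unfolding Let_def \<Phi>_def by blast
qed

end
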